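(* Let $N\ge1$, $d\in[0,1)$, let $P$ and $P'$ be nonnegative $N\times N$ matrices each of whose columns sums to one, and let $V\in\mathbb{R}^N$ be a nonnegative vector with entries summing to one. For $k\in\{1,\dots,N\}$ let $J_k$ be the $N\times N$ matrix whose only nonzero entry is $(J_k)_{kk}=1$, and let $I_d$ be the identity matrix. Let $(i_n)_{n\ge1}$ be a sequence in $\{1,\dots,N\}$, and define $$F_0=(1-d)V,\quad F_n=(I_d-J_{i_n}+dPJ_{i_n})F_{n-1},\quad H_n=\sum_{k=1}^nJ_{i_k}F_{k-1}.$$ Fix $n_0\ge0$. Let $(i'_n)_{n\ge1}$ be a sequence in $\{1,\dots,N\}$ in which every value of $\{1,\dots,N\}$ occurs infinitely often, and define $$F'_0=F_{n_0}+d(P'-P)H_{n_0},\quad F'_n=(I_d-J_{i'_n}+dP'J_{i'_n})F'_{n-1},\quad H'_n=\sum_{k=1}^nJ_{i'_k}F'_{k-1}.$$ Let $H'_\infty=\lim_{n\to\infty}H'_n$. Then $X=H_{n_0}+H'_\infty$ is the solution of $$X=dP'X+F_0.$$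
   Context: This describes restarting the fluid-diffusion PageRank computation after the transition matrix is changed from $P$ to $P'$ at iteration $n_0$: the diffusion continues with $P'$ after injecting the extra fluid $d(P'-P)H_{n_0}$. By the algebraic identity for this recursion, $H'_n+F'_n=F'_0+dP'H'_n$ for all $n$. *)

theory Defs
  imports "HOL-Analysis.Analysis"
begin

text \<open>
  In the library's matrices, \<open>A $ a $ b\<close> is the entry in row \<open>a\<close> and column \<open>b\<close>, so the sum below runs down column \<open>b\<close>.
\<close>

definition column_stochastic :: "real ^ 'n ^ 'n \<Rightarrow> bool" where
  "column_stochastic A \<longleftrightarrow>
     (\<forall>a b. 0 \<le> A $ a $ b) \<and> (\<forall>b. (\<Sum>a\<in>UNIV. A $ a $ b) = 1)"

definition probability_vector :: "real ^ 'n \<Rightarrow> bool" where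
  "probability_vector v \<longleftrightarrow> (\<forall>a. 0 \<le> v $ a) \<and> (\<Sum>a\<in>UNIV. v $ a) = 1"

definition J :: "'n::finite \<Rightarrow> real ^ 'n ^ 'n" where
  "J k = (\<chi> a b. if a = k \<and> b = k then 1 else 0)"

text \<open>
  The index sequence \<open>i\<close> is used from index 1 on only; \<open>i 0\<close> plays no role.
\<close>

primrec fluid ::
  "real \<Rightarrow> real ^ 'n ^ 'n \<Rightarrow> (nat \<Rightarrow> 'n::finite) \<Rightarrow> real ^ 'n \<Rightarrow> nat \<Rightarrow> real ^ 'n" where
  "fluid d P i F0 0 = F0"
| "fluid d P i F0 (Suc n) =
     (mat 1 - J (i (Suc n)) + d *\<^sub>R (P ** J (i (Suc n)))) *v fluid d P i F0 n"

definition history ::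
  "real \<Rightarrow> real ^ 'n ^ 'n \<Rightarrow> (nat \<Rightarrow> 'n::finite) \<Rightarrow> real ^ 'n \<Rightarrow> nat \<Rightarrow> real ^ 'n" where
  "history d P i F0 n = (\<Sum>k=1..n. J (i k) *v fluid d P i F0 (k - 1))"

end

theory Submission
  imports Defs
begin

text \<open>
  A diffusion step at node \<open>k\<close> lowers the l1-norm of the fluid by at least \<open>(1 - d)\<close> times the
  absolute amount of fluid sitting at \<open>k\<close>. Hence the diffused amounts are absolutely summable,
  whatever their signs, and the history converges. By the identity \<open>H + F = F\<^sub>0 + d P H\<close> the fluid
  then converges as well, and its limit vanishes at every node because each node is diffused
  infinitely often and the diffused amounts tend to 0. The extra fluid \<open>d (P' - P) H\<close> injected at the
  restart is exactly what turns the identity for \<open>P\<close> into the one for \<open>P'\<close>. Uniqueness holds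
  because \<open>d P'\<close> is a contraction in the l1-norm.
\<close>

lemma J_mult_vector: "J k *v x = axis k (x $ k)"
  by (simp add: J_def vec_eq_iff matrix_vector_mult_def axis_def if_distrib [of "\<lambda>c. c * _"]
      cong: if_cong conj_cong)

lemma fluid_Suc:
  "fluid d P i F0 (Suc n) = fluid d P i F0 n - J (i (Suc n)) *v fluid d P i F0 n
     + d *\<^sub>R (P *v (J (i (Suc n)) *v fluid d P i F0 n))"
  by (simp add: matrix_vector_mult_add_rdistrib matrix_vector_mult_diff_rdistrib
      scaleR_matrix_vector_assoc [symmetric] matrix_vector_mul_assoc)

lemma history_Suc:
  "history d P i F0 (Suc n) = history d P i F0 n + J (i (Suc n)) *v fluid d P i F0 n"
  by (simp add: history_def)

text \<open>A step at node \<open>k\<close> moves the fluid at \<open>k\<close> into the history,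
  which leaves the left-hand side unchanged, and then re-emits \<open>d\<close> times its image
  under \<open>P\<close>; the right-hand side grows by this same amount.\<close>

lemma history_plus_fluid:
  "history d P i F0 n + fluid d P i F0 n = F0 + d *\<^sub>R (P *v history d P i F0 n)"
proof (induction n)
  case 0
  show ?case by (simp add: history_def)
next
  case (Suc n)
  then show ?case
    unfolding history_Suc fluid_Suc
    by (simp add: algebra_simps)
qed

text \<open>The triangle inequality is applied in each row; swapping the sums then collects column
  sums, all equal to 1.\<close>

lemma column_stochastic_l1_le:
  assumes "column_stochastic A"
  shows "(\<Sum>a\<in>UNIV. \<bar>(A *v x) $ a\<bar>) \<le> (\<Sum>b\<in>UNIV. \<bar>x $ b\<bar>)"
proof -
  have nn: "0 \<le> A $ a $ b" and one: "(\<Sum>a\<in>UNIV. A $ a $ b) = 1" for a b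
    using assms by (auto simp: column_stochastic_def)
  have "(\<Sum>a\<in>UNIV. \<bar>(A *v x) $ a\<bar>) \<le> (\<Sum>a\<in>UNIV. \<Sum>b\<in>UNIV. A $ a $ b * \<bar>x $ b\<bar>)"
    unfolding matrix_vector_mult_def
    by (intro sum_mono) (auto intro!: order_trans [OF sum_abs] sum_mono simp: abs_mult nn)
  also have "\<dots> = (\<Sum>b\<in>UNIV. (\<Sum>a\<in>UNIV. A $ a $ b) * \<bar>x $ b\<bar>)"
    by (subst sum.swap) (simp add: sum_distrib_right)
  finally show ?thesis by (simp add: one)
qed

text \<open>Emptying node \<open>k\<close> takes its full absolute amount off the norm, and the
  redistribution returns at most \<open>d\<close> times that amount. Absolute values are used
  because the fluid injected at the restart can have negative entries.\<close>

lemma fluid_l1_decrease: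
  assumes "0 \<le> d" and "column_stochastic P"
  shows "(\<Sum>a\<in>UNIV. \<bar>fluid d P i F0 (Suc n) $ a\<bar>) + (1 - d) * \<bar>fluid d P i F0 n $ i (Suc n)\<bar>
           \<le> (\<Sum>a\<in>UNIV. \<bar>fluid d P i F0 n $ a\<bar>)"
proof -
  define f where "f = fluid d P i F0 n"
  define k where "k = i (Suc n)"
  have ax: "(\<Sum>a\<in>UNIV. \<bar>axis k (f $ k) $ a\<bar>) = \<bar>f $ k\<bar>"
    by (simp add: axis_def if_distrib [of abs] cong: if_cong)
  have "(\<Sum>a\<in>UNIV. \<bar>fluid d P i F0 (Suc n) $ a\<bar>)
      \<le> (\<Sum>a\<in>UNIV. \<bar>(f - axis k (f $ k)) $ a\<bar> + d * \<bar>(P *v axis k (f $ k)) $ a\<bar>)"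
    unfolding fluid_Suc J_mult_vector f_def [symmetric] k_def [symmetric]
    by (intro sum_mono) (use assms(1) in \<open>auto simp: abs_mult intro!: order_trans [OF abs_triangle_ineq]\<close>)
  also have "\<dots> = (\<Sum>a\<in>UNIV. \<bar>(f - axis k (f $ k)) $ a\<bar>) + d * (\<Sum>a\<in>UNIV. \<bar>(P *v axis k (f $ k)) $ a\<bar>)"
    by (simp add: sum.distrib sum_distrib_left)
  \<comment> \<open>Equality holds here: the axis vector agrees with \<open>f\<close> at
    \<open>k\<close> and vanishes elsewhere, so nodewise one of the two terms is zero or they
    cancel.\<close>
  also have "(\<Sum>a\<in>UNIV. \<bar>(f - axis k (f $ k)) $ a\<bar>) = (\<Sum>a\<in>UNIV. \<bar>f $ a\<bar> - \<bar>axis k (f $ k) $ a\<bar>)"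
    by (intro sum.cong) (auto simp: axis_def)
  also have "\<dots> = (\<Sum>a\<in>UNIV. \<bar>f $ a\<bar>) - \<bar>f $ k\<bar>"
    by (simp only: sum_subtractf ax)
  also have "d * (\<Sum>a\<in>UNIV. \<bar>(P *v axis k (f $ k)) $ a\<bar>) \<le> d * \<bar>f $ k\<bar>"
    using column_stochastic_l1_le [OF assms(2), of "axis k (f $ k)"] assms(1)
    unfolding ax by (rule mult_left_mono)
  finally show ?thesis
    unfolding f_def k_def by (simp add: algebra_simps)
qed

lemma diffused_fluid_summable:
  assumes "0 \<le> d" and "d < 1" and "column_stochastic P"
  shows "summable (\<lambda>n. \<bar>fluid d P i F0 n $ i (Suc n)\<bar>)"
proof (rule summableI_nonneg_bounded)
  fix n
  \<comment> \<open>Telescoping of the one-step decrease: the current norm plus all losses so far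
    stays below the initial norm.\<close>
  have "(\<Sum>a\<in>UNIV. \<bar>fluid d P i F0 n $ a\<bar>) + (1 - d) * (\<Sum>m<n. \<bar>fluid d P i F0 m $ i (Suc m)\<bar>)
          \<le> (\<Sum>a\<in>UNIV. \<bar>F0 $ a\<bar>)"
  proof (induction n)
    case (Suc n)
    then show ?case
      using fluid_l1_decrease [OF assms(1,3), of i F0 n]
      by (simp add: distrib_left del: fluid.simps(2))
  qed simp
  moreover have "0 \<le> (\<Sum>a\<in>UNIV. \<bar>fluid d P i F0 n $ a\<bar>)"
    by (simp add: sum_nonneg)
  ultimately have "(1 - d) * (\<Sum>m<n. \<bar>fluid d P i F0 m $ i (Suc m)\<bar>) \<le> (\<Sum>a\<in>UNIV. \<bar>F0 $ a\<bar>)"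
    by linarith
  then show "(\<Sum>m<n. \<bar>fluid d P i F0 m $ i (Suc m)\<bar>) \<le> (\<Sum>a\<in>UNIV. \<bar>F0 $ a\<bar>) / (1 - d)"
    using assms(2) by (simp add: pos_le_divide_eq mult.commute)
qed simp

lemma history_convergent:
  assumes "0 \<le> d" and "d < 1" and "column_stochastic P"
  shows "convergent (history d P i F0)"
proof -
  \<comment> \<open>Step \<open>Suc m\<close> acts on the fluid at time \<open>m\<close>, so the
    shift turns the history into the partial sums of a series starting at 0.\<close>
  have "history d P i F0 = (\<lambda>n. \<Sum>m<n. J (i (Suc m)) *v fluid d P i F0 m)"
  proof
    fix n
    show "history d P i F0 n = (\<Sum>m<n. J (i (Suc m)) *v fluid d P i F0 m)"
      by (induction n) (simp_all add: history_Suc, simp add: history_def)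
  qed
  \<comment> \<open>Each term is supported on a single node, so its norm is the absolute amount
    diffused there.\<close>
  moreover have "summable (\<lambda>m. J (i (Suc m)) *v fluid d P i F0 m)"
    by (rule summable_norm_cancel)
      (use diffused_fluid_summable [OF assms] in \<open>simp add: J_mult_vector norm_eq_sqrt_inner inner_axis_axis\<close>)
  ultimately show ?thesis
    by (simp add: summable_iff_convergent)
qed

lemma history_limit_fixpoint:
  assumes "0 \<le> d" and "d < 1" and "column_stochastic P"
    and inf: "\<forall>k. infinite {n. 1 \<le> n \<and> i n = k}"
    and lim: "history d P i F0 \<longlonglongrightarrow> L"
  shows "L = F0 + d *\<^sub>R (P *v L)"
proof -
  define G where "G = F0 + d *\<^sub>R (P *v L) - L"
  \<comment> \<open>Solved for the fluid, the identity shows it to be a continuous function of the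
    history, so convergence carries over.\<close>
  have eq: "fluid d P i F0 n = F0 + d *\<^sub>R (P *v history d P i F0 n) - history d P i F0 n" for n
    using history_plus_fluid [of d P i F0 n] by (simp add: algebra_simps)
  have PL: "(\<lambda>n. P *v history d P i F0 n) \<longlonglongrightarrow> P *v L"
    by (rule bounded_linear.tendsto [OF matrix_vector_mul_bounded_linear lim])
  have G: "fluid d P i F0 \<longlonglongrightarrow> G"
    unfolding G_def eq [abs_def] by (intro tendsto_intros PL lim)
  have "G $ k = 0" for k
  proof (rule ccontr)
    assume nz: "G $ k \<noteq> 0"
    have "(\<lambda>n. fluid d P i F0 n $ k) \<longlonglongrightarrow> G $ k"
      by (rule tendsto_vec_nth [OF G])
    then have "(\<lambda>n. \<bar>fluid d P i F0 n $ k\<bar>) \<longlonglongrightarrow> \<bar>G $ k\<bar>"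
      by (rule tendsto_rabs)
    \<comment> \<open>Half of the limit separates the two: eventually the fluid at \<open>k\<close>
      lies above it and every diffused amount below it, so \<open>k\<close> is no longer
      chosen.\<close>
    then have "eventually (\<lambda>n. \<bar>G $ k\<bar> / 2 < \<bar>fluid d P i F0 n $ k\<bar>) sequentially"
      by (rule order_tendstoD) (use nz in simp)
    moreover have "eventually (\<lambda>n. \<bar>fluid d P i F0 n $ i (Suc n)\<bar> < \<bar>G $ k\<bar> / 2) sequentially"
      by (rule order_tendstoD(2) [OF summable_LIMSEQ_zero [OF diffused_fluid_summable [OF assms(1-3)]]])
        (use nz in simp)
    ultimately have "eventually (\<lambda>n. i (Suc n) \<noteq> k) sequentially"
      by eventually_elim auto
    then obtain m where m: "i (Suc n) \<noteq> k" if "m \<le> n" for n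
      by (auto simp: eventually_sequentially)
    \<comment> \<open>A visit to \<open>k\<close> at time \<open>n \<ge> 1\<close> is
      \<open>i (Suc (n - 1)) = k\<close>, which forces \<open>n - 1 < m\<close>.\<close>
    have "{n. 1 \<le> n \<and> i n = k} \<subseteq> {..m}"
    proof
      fix n assume "n \<in> {n. 1 \<le> n \<and> i n = k}"
      then show "n \<in> {..m}" using m [of "n - 1"] by (cases n) force+
    qed
    then show False using inf finite_subset by blast
  qed
  then show ?thesis by (simp add: G_def vec_eq_iff)
qed

lemma damped_stochastic_fixpoint_unique:
  assumes "0 \<le> d" and "d < 1" and "column_stochastic A"
    and "x = d *\<^sub>R (A *v x) + b" and "y = d *\<^sub>R (A *v y) + b"
  shows "x = y"
proof -
  define z where "z = x - y"
  \<comment> \<open>The inhomogeneous term \<open>b\<close> cancels in the difference.\<close>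
  have "z = d *\<^sub>R (A *v z)"
    using assms(4,5) unfolding z_def
    by (metis add_diff_cancel_right matrix_vector_mult_diff_distrib scaleR_diff_right)
  then have "(\<Sum>a\<in>UNIV. \<bar>z $ a\<bar>) = (\<Sum>a\<in>UNIV. \<bar>(d *\<^sub>R (A *v z)) $ a\<bar>)" by simp
  also have "\<dots> = d * (\<Sum>a\<in>UNIV. \<bar>(A *v z) $ a\<bar>)"
    using assms(1) by (simp add: abs_mult sum_distrib_left)
  also have "\<dots> \<le> d * (\<Sum>a\<in>UNIV. \<bar>z $ a\<bar>)"
    by (rule mult_left_mono [OF column_stochastic_l1_le [OF assms(3)] assms(1)])
  finally have "(1 - d) * (\<Sum>a\<in>UNIV. \<bar>z $ a\<bar>) \<le> 0"
    by (simp add: algebra_simps)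
  then have "(\<Sum>a\<in>UNIV. \<bar>z $ a\<bar>) \<le> 0"
    using assms(2) by (simp add: mult_le_0_iff)
  then have "(\<Sum>a\<in>UNIV. \<bar>z $ a\<bar>) = 0"
    by (intro antisym) (simp_all add: sum_nonneg)
  then have "z = 0"
    by (simp add: sum_nonneg_eq_0_iff vec_eq_iff)
  then show ?thesis by (simp add: z_def)
qed

theorem theorem4:
  fixes d :: real
    and P P' :: "real ^ 'n ^ 'n"
    and V F\<^sub>0 F'\<^sub>0 X :: "real ^ 'n"
    and i i' :: "nat \<Rightarrow> 'n::finite"
    and n\<^sub>0 :: nat
    and F H H' :: "nat \<Rightarrow> real ^ 'n"
  assumes "0 \<le> d" and "d < 1"
    and "column_stochastic P" and "column_stochastic P'"
    and "probability_vector V"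
    and "\<forall>k. infinite {n. 1 \<le> n \<and> i' n = k}"
  defines "F\<^sub>0 \<equiv> (1 - d) *\<^sub>R V"
    and "F \<equiv> fluid d P i F\<^sub>0"
    and "H \<equiv> history d P i F\<^sub>0"
    and "F'\<^sub>0 \<equiv> F n\<^sub>0 + (d *\<^sub>R (P' - P)) *v H n\<^sub>0"
    and "H' \<equiv> history d P' i' F'\<^sub>0"
    and "X \<equiv> H n\<^sub>0 + lim H'"
  shows "convergent H' \<and>
         X = (d *\<^sub>R P') *v X + F\<^sub>0 \<and>
         (\<forall>Y. Y = (d *\<^sub>R P') *v Y + F\<^sub>0 \<longrightarrow> Y = X)"
proof -
  have conv: "convergent H'"
    unfolding H'_def by (rule history_convergent [OF assms(1,2,4)])
  define L where "L = lim H'"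
  have "history d P' i' F'\<^sub>0 \<longlonglongrightarrow> L"
    using conv unfolding L_def H'_def by (simp add: convergent_LIMSEQ_iff)
  then have L: "L = F'\<^sub>0 + d *\<^sub>R (P' *v L)"
    by (rule history_limit_fixpoint [OF assms(1,2,4,6)])
  have "H n\<^sub>0 + F n\<^sub>0 = F\<^sub>0 + d *\<^sub>R (P *v H n\<^sub>0)"
    unfolding H_def F_def by (rule history_plus_fluid)
  then have "H n\<^sub>0 + F'\<^sub>0 = F\<^sub>0 + d *\<^sub>R (P' *v H n\<^sub>0)"
    unfolding F'\<^sub>0_def
    by (simp add: scaleR_matrix_vector_assoc [symmetric] algebra_simps)
  \<comment> \<open>After adding \<open>P'\<close> applied to \<open>L\<close>, scaled by
    \<open>d\<close>, the bracket on the left is \<open>L\<close> by its fixpoint equation, while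
    linearity on the right merges the histories before and after the restart.\<close>
  then have "H n\<^sub>0 + (F'\<^sub>0 + d *\<^sub>R (P' *v L)) = d *\<^sub>R (P' *v (H n\<^sub>0 + L)) + F\<^sub>0"
    by (simp add: algebra_simps)
  then have X: "X = d *\<^sub>R (P' *v X) + F\<^sub>0"
    unfolding X_def L_def [symmetric] by (simp only: L [symmetric])
  show ?thesis
    unfolding scaleR_matrix_vector_assoc [symmetric]
    using conv X damped_stochastic_fixpoint_unique [OF assms(1,2,4) _ X] by blast
qed

end
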